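(* Let $\mathcal{A}$ and $\mathcal{B}$ be block upper-triangular subalgebras of $M_n$. Suppose that $\phi : \mathcal{A} \to \mathcal{B}$ is a Jordan embedding. Then one of the following is true: (a) $\mathcal{A} \subseteq \mathcal{B}$ and there exists $T \in \mathcal{B}^{\times}$ such that $\phi(X) = TXT^{-1}$ for all $X \in \mathcal{A}$; (b) $\mathcal{A}^{\odot} \subseteq \mathcal{B}$ and there exists $T \in \mathcal{B}^{\times}$ such that $\phi(X) = TX^{\odot}T^{-1}$ for all $X \in \mathcal{A}$.
   Context: $n$ is a positive integer, $M_n$ is the algebra of $n\times n$ complex matrices and $M_{p,q}$ is the space of $p\times q$ complex matrices. A block upper-triangular subalgebra of $M_n$ is a subalgebra of $M_n$ containing all upper-triangular matrices; equivalently, it is one of the algebras $\mathcal{A}_{k_1,\ldots,k_r}$, where $r,k_1,\ldots,k_r\in\mathbb{N}$ (positive integers) satisfy $k_1+\cdots+k_r=n$ and $\mathcal{A}_{k_1,\ldots,k_r}$ consists of all matrices in $M_n$ partitioned into blocks $(X_{ij})_{1\le i,j\le r}$ with $X_{ij}\in M_{k_i,k_j}$ and $X_{ij}=0$ for $i>j$ (the case $r=1$ gives $M_n$ itself). $\mathcal{B}^\times$ is the set of invertible elements of $\mathcal{B}$. For $X\in M_n$, $X^{\odot}:=JX^tJ$, where $X^t$ is the transpose and $J\in M_n$ is the matrix with entries $1$ at positions $(i,n+1-i)$, $1\le i\le n$, and $0$ elsewhere; $\mathcal{A}^{\odot}:=\{X^{\odot}: X\in\mathcal{A}\}$. A Jordan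 homomorphism between complex algebras is a linear map $\phi$ such that $\phi(a\circ b)=\phi(a)\circ\phi(b)$ for all $a,b$, where $x\circ y=xy+yx$. A Jordan embedding is an injective Jordan homomorphism. *)

theory Defs
  imports
    Complex_Main
    "Jordan_Normal_Form.Matrix"
    "Jordan_Normal_Form.Gauss_Jordan_Elimination"
begin

definition matrix_subalgebra :: "nat \<Rightarrow> complex mat set \<Rightarrow> bool" where
  "matrix_subalgebra n A \<longleftrightarrow>
     A \<subseteq> carrier_mat n n \<and>
     0\<^sub>m n n \<in> A \<and>
     (\<forall>X\<in>A. \<forall>Y\<in>A. X + Y \<in> A) \<and>
     (\<forall>c. \<forall>X\<in>A. c \<cdot>\<^sub>m X \<in> A) \<and>
     (\<forall>X\<in>A. \<forall>Y\<in>A. X * Y \<in> A)"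

definition block_upper_triangular_algebra :: "nat \<Rightarrow> complex mat set \<Rightarrow> bool" where
  "block_upper_triangular_algebra n A \<longleftrightarrow>
     matrix_subalgebra n A \<and> {X \<in> carrier_mat n n. upper_triangular X} \<subseteq> A"

definition alg_units :: "nat \<Rightarrow> complex mat set \<Rightarrow> complex mat set" where
  "alg_units n B = {T \<in> B. \<exists>S\<in>B. T * S = 1\<^sub>m n \<and> S * T = 1\<^sub>m n}"

(* Only meaningful for invertible T: mat_inverse returns None otherwise. *)
definition mat_inv :: "complex mat \<Rightarrow> complex mat" where
  "mat_inv T = the (mat_inverse T)"

(* Indices are 0-based here, so the antidiagonal positions (i, n+1-i) become i + j = n - 1. *)
definition exchange_mat :: "nat \<Rightarrow> complex mat" where
  "exchange_mat n = mat n n (\<lambda>(i, j). if Suc (i + j) = n then 1 else 0)"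

definition odot :: "nat \<Rightarrow> complex mat \<Rightarrow> complex mat" where
  "odot n X = exchange_mat n * transpose_mat X * exchange_mat n"

definition jordan_prod :: "complex mat \<Rightarrow> complex mat \<Rightarrow> complex mat" where
  "jordan_prod X Y = X * Y + Y * X"

(* phi is a total function on the type of all matrices; only its values on A matter. *)
definition jordan_hom :: "complex mat set \<Rightarrow> complex mat set \<Rightarrow> (complex mat \<Rightarrow> complex mat) \<Rightarrow> bool" where
  "jordan_hom A B \<phi> \<longleftrightarrow>
     \<phi> ` A \<subseteq> B \<and>
     (\<forall>X\<in>A. \<forall>Y\<in>A. \<phi> (X + Y) = \<phi> X + \<phi> Y) \<and>
     (\<forall>c. \<forall>X\<in>A. \<phi> (c \<cdot>\<^sub>m X) = c \<cdot>\<^sub>m \<phi> X) \<and>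
     (\<forall>X\<in>A. \<forall>Y\<in>A. \<phi> (jordan_prod X Y) = jordan_prod (\<phi> X) (\<phi> Y))"

definition jordan_embedding :: "complex mat set \<Rightarrow> complex mat set \<Rightarrow> (complex mat \<Rightarrow> complex mat) \<Rightarrow> bool" where
  "jordan_embedding A B \<phi> \<longleftrightarrow> jordan_hom A B \<phi> \<and> inj_on \<phi> A"

end

theory Submission
  imports Defs "Jordan_Normal_Form.Determinant"
begin

text \<open>
  A Jordan embedding maps the diagonal matrix units to \<open>n\<close> nonzero orthogonal idempotents, which
  are simultaneously diagonalizable; after a conjugation it fixes the diagonal units. The relations
  \<open>E\<^sub>i\<^sub>i \<circ> E\<^sub>i\<^sub>j = E\<^sub>i\<^sub>j = E\<^sub>j\<^sub>j \<circ> E\<^sub>i\<^sub>j\<close> and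
  \<open>E\<^sub>i\<^sub>j\<^sup>2 = 0\<close> then force \<open>E\<^sub>i\<^sub>j\<close> to go to a nonzero multiple
  of \<open>E\<^sub>i\<^sub>j\<close> or of \<open>E\<^sub>j\<^sub>i\<close>, and
  \<open>E\<^sub>i\<^sub>j \<circ> E\<^sub>j\<^sub>k = E\<^sub>i\<^sub>k\<close> forces the same alternative for all pairs
  and makes the multiples a coboundary \<open>g\<^sub>j / g\<^sub>i\<close>, which a diagonal conjugation absorbs.
  Hence \<open>\<phi>\<close> is \<open>X \<mapsto> T X T\<^sup>-\<^sup>1\<close> or the same with \<open>X\<^sup>t\<close>. Finally \<open>T\<close> lies in \<open>B\<close>,
  for otherwise the inclusion of the conjugated upper-triangular matrices in \<open>B\<close> would force on
  \<open>T\<^sup>-\<^sup>1\<close> a zero block too large for an invertible matrix.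
\<close>

section \<open>Matrix units and their products\<close>

definition mat_unit :: "nat \<Rightarrow> nat \<Rightarrow> nat \<Rightarrow> 'a :: semiring_1 mat" where
  "mat_unit n i j = mat n n (\<lambda>(a, b). if a = i \<and> b = j then 1 else 0)"

lemma mat_unit_carrier [simp]: "mat_unit n i j \<in> carrier_mat n n"
  by (simp add: mat_unit_def)

lemma mat_unit_dim [simp]: "dim_row (mat_unit n i j) = n" "dim_col (mat_unit n i j) = n"
  by (simp_all add: mat_unit_def)

lemma mat_unit_index [simp]:
  "a < n \<Longrightarrow> b < n \<Longrightarrow> mat_unit n i j $$ (a, b) = (if a = i \<and> b = j then 1 else 0)"
  by (simp add: mat_unit_def)

lemma mult_mat_index:
  assumes "X \<in> carrier_mat n m" "Y \<in> carrier_mat m k" "a < n" "b < k"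
  shows "(X * Y) $$ (a, b) = (\<Sum>c<m. X $$ (a, c) * Y $$ (c, b))"
proof -
  have "(X * Y) $$ (a, b) = (\<Sum>c\<in>{0..<m}. X $$ (a, c) * Y $$ (c, b))"
    using assms by (simp add: scalar_prod_def)
  then show ?thesis by (simp add: atLeast0LessThan)
qed

lemma mat_unit_mult_index:
  assumes "X \<in> carrier_mat n n" "a < n" "b < n" "j < n"
  shows "(mat_unit n i j * X) $$ (a, b) = (if a = i then X $$ (j, b) else 0)"
proof -
  have "(mat_unit n i j * X) $$ (a, b) = (\<Sum>c<n. if c = j then (if a = i then X $$ (c, b) else 0) else 0)"
    unfolding mult_mat_index[OF mat_unit_carrier assms(1-3)]
    by (rule sum.cong) (use assms in auto)
  then show ?thesis using assms by simp
qed

lemma mult_mat_unit_index: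
  assumes "X \<in> carrier_mat n n" "a < n" "b < n" "i < n"
  shows "(X * mat_unit n i j) $$ (a, b) = (if b = j then X $$ (a, i) else 0)"
proof -
  have "(X * mat_unit n i j) $$ (a, b) = (\<Sum>c<n. if c = i then (if b = j then X $$ (a, c) else 0) else 0)"
    unfolding mult_mat_index[OF assms(1) mat_unit_carrier assms(2,3)]
    by (rule sum.cong) (use assms in auto)
  then show ?thesis using assms by simp
qed

lemma mat_unit_mult_mat_unit:
  assumes "j < n" "k < n"
  shows "mat_unit n i j * mat_unit n k l = (if j = k then mat_unit n i l else 0\<^sub>m n n)"
  by (rule eq_matI) (use assms in \<open>auto simp: mat_unit_mult_index simp del: index_mult_mat(1)\<close>)

text \<open>The product is column \<open>k\<close> of \<open>X\<close> times row \<open>l\<close> of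
  \<open>Y\<close>. Over a field its entry is therefore nonzero as soon as both factors are, which
  later detects matrix units in an algebra.\<close>

lemma conj_mat_unit_index:
  assumes "X \<in> carrier_mat n n" "Y \<in> carrier_mat n n" "a < n" "b < n" "k < n" "l < n"
  shows "(X * mat_unit n k l * Y) $$ (a, b) = X $$ (a, k) * Y $$ (l, b)"
proof -
  have "(X * mat_unit n k l * Y) $$ (a, b) = (\<Sum>c<n. if c = l then X $$ (a, k) * Y $$ (c, b) else 0)"
    using assms mult_mat_index[of "X * mat_unit n k l" n n Y n a b]
    by (auto simp: mult_mat_unit_index if_distrib[where f = "\<lambda>z. z * _"] simp del: index_mult_mat(1) cong: if_cong)
  then show ?thesis using assms by simp
qed

lemma transpose_mat_unit: "transpose_mat (mat_unit n i j) = mat_unit n j i"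
  by (rule eq_matI) auto

section \<open>Block algebras as spans of matrix units\<close>

text \<open>Linearity is asked only on \<open>A\<close>, since \<phi> is arbitrary elsewhere. The
  sizes of the values are left open and appear as separate hypotheses where they matter.\<close>

definition linear_on_mats ::
  "complex mat set \<Rightarrow> (complex mat \<Rightarrow> complex mat) \<Rightarrow> bool" where
  "linear_on_mats A f \<longleftrightarrow> (\<forall>X\<in>A. \<forall>Y\<in>A. f (X + Y) = f X + f Y) \<and>
     (\<forall>c. \<forall>X\<in>A. f (c \<cdot>\<^sub>m X) = c \<cdot>\<^sub>m f X)"

text \<open>The diagonal units are upper triangular, hence in \<open>A\<close>, and multiplying
  \<open>X\<close> by them on both sides cuts out a single entry.\<close>

lemma smult_mat_unit_mem:
  assumes "block_upper_triangular_algebra n A" "X \<in> A" "i < n" "j < n"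
  shows "X $$ (i, j) \<cdot>\<^sub>m mat_unit n i j \<in> A"
proof -
  have X: "X \<in> carrier_mat n n"
    using assms unfolding block_upper_triangular_algebra_def matrix_subalgebra_def by auto
  have mult: "Y * Z \<in> A" if "Y \<in> A" "Z \<in> A" for Y Z
    using assms that unfolding block_upper_triangular_algebra_def matrix_subalgebra_def by auto
  have diag: "mat_unit n k k \<in> A" for k
    using assms unfolding block_upper_triangular_algebra_def by (auto simp: upper_triangular_def)
  have "mat_unit n i i * X * mat_unit n j j = X $$ (i, j) \<cdot>\<^sub>m mat_unit n i j"
    by (rule eq_matI)
      (use X assms mult_carrier_mat[OF mat_unit_carrier X] in
        \<open>auto simp: mat_unit_mult_index mult_mat_unit_index simp del: index_mult_mat(1)\<close>)
  moreover have "mat_unit n i i * X * mat_unit n j j \<in> A"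
    by (intro mult diag assms)
  ultimately show ?thesis by simp
qed

lemma mat_unit_mem:
  assumes A: "block_upper_triangular_algebra n A" and "X \<in> A" "i < n" "j < n" "X $$ (i, j) \<noteq> 0"
  shows "mat_unit n i j \<in> A"
proof -
  have "inverse (X $$ (i, j)) \<cdot>\<^sub>m (X $$ (i, j) \<cdot>\<^sub>m mat_unit n i j) \<in> A"
    using smult_mat_unit_mem[OF assms(1-4)] A
    unfolding block_upper_triangular_algebra_def matrix_subalgebra_def by blast
  moreover have "inverse (X $$ (i, j)) \<cdot>\<^sub>m (X $$ (i, j) \<cdot>\<^sub>m mat_unit n i j) = mat_unit n i j"
    by (rule eq_matI) (use assms in auto)
  ultimately show ?thesis by simp
qed

lemma mat_unit_mem_upper:
  assumes "block_upper_triangular_algebra n A" "i \<le> j" "j < n"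
  shows "mat_unit n i j \<in> A"
  using assms unfolding block_upper_triangular_algebra_def by (auto simp: upper_triangular_def)

text \<open>Together with \<open>mat_unit_mem_upper\<close> this makes the relation
  "\<open>E_ij\<close> lies in \<open>A\<close>" a preorder on the indices that extends \<le>. The
  block shape enters the later index arguments in this form.\<close>

lemma mat_unit_mem_trans:
  assumes "block_upper_triangular_algebra n A" "j < n"
    and "mat_unit n i j \<in> A" "mat_unit n j k \<in> A"
  shows "mat_unit n i k \<in> A"
proof -
  have "mat_unit n i j * mat_unit n j k \<in> A"
    using assms unfolding block_upper_triangular_algebra_def matrix_subalgebra_def by blast
  then show ?thesis using assms by (simp add: mat_unit_mult_mat_unit)
qed

text \<open>The matrix is built up one entry at a time. Zero entries are skipped, so every unit that
  gets added lies in \<open>A\<close>. Membership is part of the conclusion, so the rule serves both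
  membership proofs and linear extension.\<close>

lemma mat_unit_induct:
  assumes A: "block_upper_triangular_algebra n A"
    and X: "X \<in> carrier_mat n n" "\<And>i j. i < n \<Longrightarrow> j < n \<Longrightarrow> X $$ (i, j) \<noteq> 0 \<Longrightarrow> mat_unit n i j \<in> A"
    and zero: "P (0\<^sub>m n n)"
    and add: "\<And>Y c i j. Y \<in> A \<Longrightarrow> P Y \<Longrightarrow> i < n \<Longrightarrow> j < n \<Longrightarrow> mat_unit n i j \<in> A \<Longrightarrow>
        P (Y + c \<cdot>\<^sub>m mat_unit n i j)"
  shows "X \<in> A \<and> P X"
proof -
  \<comment> \<open>\<open>R F\<close> keeps the entries of \<open>X\<close> at the positions in
    \<open>F\<close> and is zero elsewhere.\<close>
  define R where "R F = mat n n (\<lambda>(i, j). if (i, j) \<in> F then X $$ (i, j) else 0)" for F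
  have "R F \<in> A \<and> P (R F)" if "finite F" "F \<subseteq> {..<n} \<times> {..<n}" for F
    using that
  proof (induction F rule: finite_induct)
    case empty
    have "R {} = 0\<^sub>m n n" by (rule eq_matI) (auto simp: R_def)
    then show ?case
      using zero A unfolding block_upper_triangular_algebra_def matrix_subalgebra_def by simp
  next
    case (insert x F)
    obtain i j where x: "x = (i, j)" by (cases x)
    have ij: "i < n" "j < n" using insert x by auto
    have IH: "R F \<in> A" "P (R F)" using insert by auto
    show ?case
    proof (cases "X $$ (i, j) = 0")
      case True
      then have "R (insert x F) = R F" by (auto intro!: eq_matI simp: R_def x)
      then show ?thesis using IH by simp
    next
      case False
      have E: "mat_unit n i j \<in> A" using X(2) ij False by blast
      have "R (insert x F) = R F + X $$ (i, j) \<cdot>\<^sub>m mat_unit n i j"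
        by (rule eq_matI) (use insert x in \<open>auto simp: R_def\<close>)
      moreover have "R F + X $$ (i, j) \<cdot>\<^sub>m mat_unit n i j \<in> A"
        using A IH E unfolding block_upper_triangular_algebra_def matrix_subalgebra_def by blast
      ultimately show ?thesis using add[OF IH ij E] by simp
    qed
  qed
  from this[of "{..<n} \<times> {..<n}"] have "R ({..<n} \<times> {..<n}) \<in> A \<and> P (R ({..<n} \<times> {..<n}))"
    by simp
  moreover have "R ({..<n} \<times> {..<n}) = X" by (rule eq_matI) (use X in \<open>auto simp: R_def\<close>)
  ultimately show ?thesis by simp
qed

lemma mem_if_mat_units_mem:
  assumes "block_upper_triangular_algebra n A" "X \<in> carrier_mat n n"
    and "\<And>i j. i < n \<Longrightarrow> j < n \<Longrightarrow> X $$ (i, j) \<noteq> 0 \<Longrightarrow> mat_unit n i j \<in> A"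
  shows "X \<in> A"
  using mat_unit_induct[where P = "\<lambda>_. True", OF assms] by blast

text \<open>The value at zero is 0 times itself, a zero matrix whose size is that of the value; the
  carrier hypothesis fixes this size.\<close>

lemma linear_on_mats_zero:
  assumes f: "linear_on_mats A f" and A: "0\<^sub>m n n \<in> A" and car: "f (0\<^sub>m n n) \<in> carrier_mat n n"
  shows "f (0\<^sub>m n n) = 0\<^sub>m n n"
proof -
  have "f (0 \<cdot>\<^sub>m 0\<^sub>m n n) = 0 \<cdot>\<^sub>m f (0\<^sub>m n n)" using f A unfolding linear_on_mats_def by blast
  also have "\<dots> = 0\<^sub>m n n" by (rule eq_matI) (use car in auto)
  finally show ?thesis by simp
qed

text \<open>The units contained in \<open>A\<close> span \<open>A\<close>, so a linear map on
  \<open>A\<close> is determined by its values on them.\<close>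

lemma linear_on_mats_eqI:
  assumes A: "block_upper_triangular_algebra n A"
    and f: "linear_on_mats A f" and g: "linear_on_mats A g"
    and car: "f (0\<^sub>m n n) \<in> carrier_mat n n" "g (0\<^sub>m n n) \<in> carrier_mat n n"
    and eq: "\<And>i j. i < n \<Longrightarrow> j < n \<Longrightarrow> mat_unit n i j \<in> A \<Longrightarrow> f (mat_unit n i j) = g (mat_unit n i j)"
    and X: "X \<in> A"
  shows "f X = g X"
proof -
  have Xc: "X \<in> carrier_mat n n" and zA: "0\<^sub>m n n \<in> A"
    and sm: "\<And>c Y. Y \<in> A \<Longrightarrow> c \<cdot>\<^sub>m Y \<in> A"
    using A X unfolding block_upper_triangular_algebra_def matrix_subalgebra_def by auto
  have lin: "h (Y + c \<cdot>\<^sub>m Z) = h Y + c \<cdot>\<^sub>m h Z"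
    if "linear_on_mats A h" "Y \<in> A" "Z \<in> A" for h Y Z c
    using that sm unfolding linear_on_mats_def by simp
  have zero: "h (0\<^sub>m n n) = 0\<^sub>m n n" if "linear_on_mats A h" "h (0\<^sub>m n n) \<in> carrier_mat n n" for h
    using linear_on_mats_zero[OF that(1) zA that(2)] .
  have "X \<in> A \<and> f X = g X"
  proof (rule mat_unit_induct[OF A Xc])
    show "mat_unit n i j \<in> A" if "i < n" "j < n" "X $$ (i, j) \<noteq> 0" for i j
      using mat_unit_mem[OF A X] that by blast
  qed (use f g car eq in \<open>auto simp: zero lin\<close>)
  then show ?thesis by simp
qed

section \<open>Membership of a conjugating matrix in a block algebra\<close>

text \<open>The \<open>n - k\<close> rows from \<open>k\<close> on are supported in the
  \<open>n - k - 1\<close> columns after \<open>k\<close>. By pigeonhole every permutation meets a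
  zero entry in these rows, so each term of the Leibniz formula vanishes.\<close>

lemma det_zero_block:
  fixes S :: "'a :: comm_ring_1 mat"
  assumes S: "S \<in> carrier_mat n n" and k: "k < n"
    and zero: "\<And>i j. k \<le> i \<Longrightarrow> i < n \<Longrightarrow> j \<le> k \<Longrightarrow> S $$ (i, j) = 0"
  shows "det S = 0"
proof -
  have "(\<Prod>i = 0..<n. S $$ (i, p i)) = 0" if p: "p permutes {0..<n}" for p
  proof (rule ccontr)
    assume nz: "(\<Prod>i = 0..<n. S $$ (i, p i)) \<noteq> 0"
    have "p i \<in> {k<..<n}" if i: "i \<in> {k..<n}" for i
    proof -
      have "S $$ (i, p i) \<noteq> 0"
      proof
        assume "S $$ (i, p i) = 0"
        then have "(\<Prod>i = 0..<n. S $$ (i, p i)) = 0" using i by (intro prod_zero) auto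
        with nz show False by simp
      qed
      then have "\<not> p i \<le> k" using zero i by auto
      moreover have "p i < n" using permutes_in_image[OF p, of i] i by auto
      ultimately show ?thesis by auto
    qed
    then have "p ` {k..<n} \<subseteq> {k<..<n}" by blast
    moreover have "inj_on p {k..<n}" using permutes_inj[OF p] by (rule inj_on_subset) simp
    ultimately have "card {k..<n} \<le> card {k<..<n}" by (intro card_inj_on_le) auto
    then show False using k by simp
  qed
  then show ?thesis unfolding det_def'[OF S] by simp
qed

lemma inverse_pair_det_nonzero:
  fixes T S :: "'a :: comm_ring_1 mat"
  assumes "T \<in> carrier_mat n n" "S \<in> carrier_mat n n" "T * S = 1\<^sub>m n"
  shows "det T \<noteq> 0" "det S \<noteq> 0"
proof -
  have "det T * det S = 1" using det_mult[OF assms(1,2)] assms(3) by simp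
  then show "det T \<noteq> 0" "det S \<noteq> 0" by auto
qed

text \<open>Nonzero \<open>T_ik\<close> and \<open>S_lj\<close> with \<open>k \<le> l\<close> make
  entry \<open>(i, j)\<close> of \<open>T E_kl S\<close> nonzero and so put \<open>E_ij\<close> into
  \<open>B\<close>. If some nonzero \<open>T_ik\<close> had \<open>E_ik\<close> outside
  \<open>B\<close>, then \<open>S\<close> would have the zero block of \<open>det_zero_block\<close>
  and be singular. The same argument with \<open>T\<close> and \<open>S\<close> exchanged treats
  \<open>S\<close>.\<close>

lemma conj_upper_units_mem:
  assumes B: "block_upper_triangular_algebra n B"
    and T: "T \<in> carrier_mat n n" and S: "S \<in> carrier_mat n n" and TS: "T * S = 1\<^sub>m n"
    and conj: "\<And>k l. k \<le> l \<Longrightarrow> l < n \<Longrightarrow> T * mat_unit n k l * S \<in> B"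
  shows "T \<in> B" "S \<in> B"
proof -
  have mem: "mat_unit n i j \<in> B"
    if "k \<le> l" "l < n" "i < n" "j < n" "T $$ (i, k) \<noteq> 0" "S $$ (l, j) \<noteq> 0" for i j k l
  proof (rule mat_unit_mem[OF B conj])
    show "(T * mat_unit n k l * S) $$ (i, j) \<noteq> 0"
      using that T S by (simp add: conj_mat_unit_index del: index_mult_mat(1))
  qed (use that in auto)
  note upper = mat_unit_mem_upper[OF B] and trans = mat_unit_mem_trans[OF B]
  show "T \<in> B"
  proof (rule mem_if_mat_units_mem[OF B T], rule ccontr)
    fix i k assume ik: "i < n" "k < n" "T $$ (i, k) \<noteq> 0" "mat_unit n i k \<notin> B"
    have "det S = 0"
    proof (rule det_zero_block[OF S ik(2)], rule ccontr)
      fix l j assume lj: "k \<le> l" "l < n" "j \<le> k" "S $$ (l, j) \<noteq> 0"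
      then have "mat_unit n i j \<in> B" using mem[of k l i j] ik by auto
      \<comment> \<open>\<open>E_jk\<close> is in \<open>B\<close> because \<open>j \<le> k\<close>,
        so \<open>E_ij\<close> in \<open>B\<close> would give \<open>E_ik = E_ij E_jk\<close> in
        \<open>B\<close>.\<close>
      then show False using trans[of j i k] upper[of j k] lj ik by auto
    qed
    then show False using inverse_pair_det_nonzero[OF T S TS] by simp
  qed
  show "S \<in> B"
  proof (rule mem_if_mat_units_mem[OF B S], rule ccontr)
    fix l j assume lj: "l < n" "j < n" "S $$ (l, j) \<noteq> 0" "mat_unit n l j \<notin> B"
    have "det T = 0"
    proof (rule det_zero_block[OF T lj(1)], rule ccontr)
      fix i k assume ik: "l \<le> i" "i < n" "k \<le> l" "T $$ (i, k) \<noteq> 0"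
      then have "mat_unit n i j \<in> B" using mem[of k l i j] lj by auto
      \<comment> \<open>Here the upper-triangular unit \<open>E_li\<close> multiplies from the left:
        \<open>E_lj = E_li E_ij\<close>.\<close>
      then show False using trans[of i l j] upper[of l i] lj ik by auto
    qed
    then show False using inverse_pair_det_nonzero[OF T S TS] by simp
  qed
qed

section \<open>Simultaneous diagonalization of orthogonal idempotents\<close>

text \<open>Multiplying \<open>P Q + Q P = 0\<close> by \<open>P\<close> on the left and on the
  right gives \<open>P Q = - P Q P = Q P\<close>. Hence \<open>2 P Q = 0\<close>, and 2 is
  invertible.\<close>

lemma jordan_orthogonal_idempotents:
  fixes P Q :: "complex mat"
  assumes P: "P \<in> carrier_mat n n" and Q: "Q \<in> carrier_mat n n"
    and PP: "P * P = P" and J: "jordan_prod P Q = 0\<^sub>m n n"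
  shows "P * Q = 0\<^sub>m n n"
proof -
  have sum: "P * Q + Q * P = 0\<^sub>m n n" using J by (simp add: jordan_prod_def)
  have "P * (P * Q + Q * P) = P * (P * Q) + P * (Q * P)"
    by (rule mult_add_distrib_mat[where n = n]) (use P Q in auto)
  also have "P * (P * Q) = P * Q" using assoc_mult_mat[OF P P Q] PP by simp
  finally have l: "P * Q + P * Q * P = 0\<^sub>m n n" using sum P assoc_mult_mat[OF P Q P] by simp
  have "(P * Q + Q * P) * P = P * Q * P + Q * P * P"
    by (rule add_mult_distrib_mat[where nr = n]) (use P Q in auto)
  also have "Q * P * P = Q * P" using assoc_mult_mat[OF Q P P] PP by simp
  finally have r: "P * Q * P + Q * P = 0\<^sub>m n n" using sum P by simp
  show ?thesis
  proof (rule eq_matI)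
    fix i j assume "i < dim_row (0\<^sub>m n n)" "j < dim_col (0\<^sub>m n n)"
    then have ij: "i < n" "j < n" by auto
    have idx: "(X + Y) $$ (i, j) = X $$ (i, j) + Y $$ (i, j)" if "Y \<in> carrier_mat n n" for X Y :: "complex mat"
      using that ij by auto
    have "(P * Q) $$ (i, j) + (Q * P) $$ (i, j) = 0"
      "(P * Q) $$ (i, j) + (P * Q * P) $$ (i, j) = 0"
      "(P * Q * P) $$ (i, j) + (Q * P) $$ (i, j) = 0"
      using idx[of "Q * P" "P * Q"] idx[of "P * Q * P" "P * Q"] idx[of "Q * P" "P * Q * P"]
        sum l r P Q ij by (simp_all del: index_mult_mat(1) index_add_mat(1))
    then have "(P * Q) $$ (i, j) = 0"
      by (simp add: add_eq_0_iff2)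
    then show "(P * Q) $$ (i, j) = 0\<^sub>m n n $$ (i, j)" using ij by simp
  qed (use P Q in auto)
qed

lemma inverse_if_det_nonzero:
  fixes T :: "'a :: field mat"
  assumes T: "T \<in> carrier_mat n n" and "det T \<noteq> 0"
  obtains S where "S \<in> carrier_mat n n" "T * S = 1\<^sub>m n" "S * T = 1\<^sub>m n"
  using det_non_zero_imp_unit[OF assms, of "()"]
  by (auto simp: Units_def ring_mat_def)

text \<open>A nonzero column of \<open>P i\<close> is fixed by \<open>P i\<close> and killed by the
  other idempotents. One such column for each \<open>i\<close> gives \<open>n\<close> independent
  vectors, a common eigenbasis.\<close>

lemma orthogonal_idempotents_diagonalize:
  fixes P :: "nat \<Rightarrow> 'a :: field mat"
  assumes P: "\<And>i. i < n \<Longrightarrow> P i \<in> carrier_mat n n"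
    and idem: "\<And>i. i < n \<Longrightarrow> P i * P i = P i"
    and orth: "\<And>i j. i < n \<Longrightarrow> j < n \<Longrightarrow> i \<noteq> j \<Longrightarrow> P i * P j = 0\<^sub>m n n"
    and nz: "\<And>i. i < n \<Longrightarrow> P i \<noteq> 0\<^sub>m n n"
  obtains T S where "T \<in> carrier_mat n n" "S \<in> carrier_mat n n" "T * S = 1\<^sub>m n" "S * T = 1\<^sub>m n"
    "\<And>i. i < n \<Longrightarrow> S * P i * T = mat_unit n i i"
proof -
  have "\<exists>w a. w < n \<and> a < n \<and> P i $$ (a, w) \<noteq> 0" if i: "i < n" for i
  proof (rule ccontr)
    assume "\<not> ?thesis"
    then have "P i = 0\<^sub>m n n" using P[OF i] by (intro eq_matI) auto
    with nz[OF i] show False by simp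
  qed
  then obtain w a where w: "\<And>i. i < n \<Longrightarrow> w i < n" and a: "\<And>i. i < n \<Longrightarrow> a i < n"
    and wa: "\<And>i. i < n \<Longrightarrow> P i $$ (a i, w i) \<noteq> 0"
    by metis
  \<comment> \<open>Column \<open>i\<close> of \<open>T\<close> is column \<open>w i\<close> of
    \<open>P i\<close>, and \<open>a i\<close> is a position where this column is nonzero.\<close>
  define T where "T = mat n n (\<lambda>(c, i). P i $$ (c, w i))"
  have T: "T \<in> carrier_mat n n" by (simp add: T_def)
  have PT: "P i * T = T * mat_unit n i i" if i: "i < n" for i
  proof (rule eq_matI)
    fix c b assume "c < dim_row (T * mat_unit n i i)" "b < dim_col (T * mat_unit n i i)"
    then have cb: "c < n" "b < n" using T by auto
    \<comment> \<open>The sum is an entry of \<open>P i * P b\<close>, which idempotence and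
      orthogonality evaluate.\<close>
    have "(P i * T) $$ (c, b) = (\<Sum>d<n. P i $$ (c, d) * P b $$ (d, w b))"
      using mult_mat_index[OF P[OF i] T cb] cb by (simp add: T_def)
    also have "\<dots> = (P i * P b) $$ (c, w b)"
      using mult_mat_index[OF P[OF i] P[OF cb(2)] cb(1) w[OF cb(2)]] by simp
    also have "\<dots> = (if b = i then T $$ (c, i) else 0)"
      using idem[OF i] orth[OF i cb(2)] cb w by (auto simp: T_def)
    also have "\<dots> = (T * mat_unit n i i) $$ (c, b)"
      using mult_mat_unit_index[OF T cb i] by simp
    finally show "(P i * T) $$ (c, b) = (T * mat_unit n i i) $$ (c, b)" .
  qed (use T P[OF i] in auto)
  have "det T \<noteq> 0"
  proof
    assume "det T = 0"
    then obtain v where v: "v \<in> carrier_vec n" "v \<noteq> 0\<^sub>v n" "T *\<^sub>v v = 0\<^sub>v n"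
      using det_0_iff_vec_prod_zero_field[OF T] by auto
    then obtain i where i: "i < n" "v $ i \<noteq> 0"
      by (metis carrier_vecD eq_vecI index_zero_vec(1) index_zero_vec(2))
    \<comment> \<open>Applying \<open>P i\<close> to \<open>T v = 0\<close> isolates
      \<open>v_i\<close> times column \<open>i\<close> of \<open>T\<close>; reading it at position
      \<open>a i\<close> contradicts \<open>v_i \<noteq> 0\<close>.\<close>
    have "(T * mat_unit n i i) *\<^sub>v v = P i *\<^sub>v (T *\<^sub>v v)"
      using PT[OF i(1)] assoc_mult_mat_vec[OF P[OF i(1)] T v(1)] by simp
    also have "\<dots> = 0\<^sub>v n" using v P[OF i(1)] by (intro eq_vecI) (simp_all add: scalar_prod_def)
    finally have "((T * mat_unit n i i) *\<^sub>v v) $ a i = 0" using a[OF i(1)] by simp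
    moreover have "((T * mat_unit n i i) *\<^sub>v v) $ a i = (\<Sum>b = 0..<n. (T * mat_unit n i i) $$ (a i, b) * v $ b)"
      using T a[OF i(1)] v(1) by (simp add: scalar_prod_def del: index_mult_mat(1))
    moreover have "\<dots> = (\<Sum>b = 0..<n. if b = i then T $$ (a i, i) * v $ i else 0)"
      using mult_mat_unit_index[OF T a[OF i(1)] _ i(1)] by (intro sum.cong) auto
    ultimately have "T $$ (a i, i) * v $ i = 0" using i by simp
    then show False using i wa a by (simp add: T_def)
  qed
  then obtain S where S: "S \<in> carrier_mat n n" "T * S = 1\<^sub>m n" "S * T = 1\<^sub>m n"
    using inverse_if_det_nonzero[OF T] by blast
  have "S * P i * T = mat_unit n i i" if i: "i < n" for i
  proof -
    have "S * P i * T = S * (T * mat_unit n i i)"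
      using PT[OF i] assoc_mult_mat[OF S(1) P[OF i] T] by simp
    also have "\<dots> = S * T * mat_unit n i i"
      using assoc_mult_mat[OF S(1) T mat_unit_carrier] by simp
    finally show ?thesis using S by simp
  qed
  with that[OF T S] show ?thesis by blast
qed

section \<open>Multiplicative cocycles on a preorder\<close>

text \<open>In the application \<open>c i j\<close> and \<open>d i j\<close> are the coefficients of
  \<open>E_ij\<close> and \<open>E_ji\<close> in the image of \<open>E_ij\<close>. Exactly one of
  them is nonzero for each related pair; the proof compares every pair with the pair
  \<open>(0, 1)\<close>.\<close>

lemma cocycle_dichotomy:
  fixes c d :: "nat \<Rightarrow> nat \<Rightarrow> 'a :: field"
  assumes upper: "\<And>i j. i \<le> j \<Longrightarrow> j < n \<Longrightarrow> R i j"
    and trans: "\<And>i j k. i < n \<Longrightarrow> j < n \<Longrightarrow> k < n \<Longrightarrow> R i j \<Longrightarrow> R j k \<Longrightarrow> R i k"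
    and excl: "\<And>i j. i < n \<Longrightarrow> j < n \<Longrightarrow> i \<noteq> j \<Longrightarrow> R i j \<Longrightarrow> c i j * d i j = 0"
    and nz: "\<And>i j. i < n \<Longrightarrow> j < n \<Longrightarrow> i \<noteq> j \<Longrightarrow> R i j \<Longrightarrow> c i j \<noteq> 0 \<or> d i j \<noteq> 0"
    and trip: "\<And>i j k. i < n \<Longrightarrow> j < n \<Longrightarrow> k < n \<Longrightarrow> i \<noteq> j \<Longrightarrow> j \<noteq> k \<Longrightarrow> i \<noteq> k \<Longrightarrow> R i j \<Longrightarrow> R j k \<Longrightarrow>
        c i k = c i j * c j k \<and> d i k = d i j * d j k"
    and pair: "\<And>i j. i < n \<Longrightarrow> j < n \<Longrightarrow> i \<noteq> j \<Longrightarrow> R i j \<Longrightarrow> R j i \<Longrightarrow>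
        c i j * c j i + d i j * d j i = 1"
  shows "(\<forall>i<n. \<forall>j<n. i \<noteq> j \<longrightarrow> R i j \<longrightarrow> d i j = 0 \<and> c i j \<noteq> 0) \<or>
    (\<forall>i<n. \<forall>j<n. i \<noteq> j \<longrightarrow> R i j \<longrightarrow> c i j = 0 \<and> d i j \<noteq> 0)"
proof -
  have xor: "d i j = 0 \<longleftrightarrow> c i j \<noteq> 0" if "i < n" "j < n" "i \<noteq> j" "R i j" for i j
    using excl[OF that] nz[OF that] by auto
  \<comment> \<open>If \<open>(i, j)\<close> and \<open>(j, k)\<close> were of different kinds, both
    products in \<open>trip\<close> would vanish, contradicting \<open>nz\<close> for
    \<open>(i, k)\<close>.\<close>
  have tr: "(c i j \<noteq> 0 \<longleftrightarrow> c i k \<noteq> 0) \<and> (c j k \<noteq> 0 \<longleftrightarrow> c i k \<noteq> 0)"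
    if "i < n" "j < n" "k < n" "i \<noteq> j" "j \<noteq> k" "i \<noteq> k" "R i j" "R j k" for i j k
    using trip[OF that] xor[of i j] xor[of j k] xor[of i k] trans[of i j k] that by auto
  \<comment> \<open>The comparison runs from \<open>(i, j)\<close> to \<open>(0, j)\<close> to
    \<open>(0, 1)\<close>. The bounds on \<open>i\<close> and \<open>j\<close> give
    \<open>1 < n\<close>, so the reference pair is admissible.\<close>
  have lt: "c i j \<noteq> 0 \<longleftrightarrow> c 0 1 \<noteq> 0" if ij: "i < j" "j < n" for i j
  proof -
    have "c 0 j \<noteq> 0 \<longleftrightarrow> c 0 1 \<noteq> 0"
      using tr[of 0 1 j] upper[of 0 1] upper[of 1 j] ij by (cases "j = 1") auto
    moreover have "c i j \<noteq> 0 \<longleftrightarrow> c 0 j \<noteq> 0"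
      using tr[of 0 i j] upper[of 0 i] upper[of i j] ij by (cases "i = 0") auto
    ultimately show ?thesis by simp
  qed
  have all: "c i j \<noteq> 0 \<longleftrightarrow> c 0 1 \<noteq> 0" if ij: "i < n" "j < n" "i \<noteq> j" "R i j" for i j
  proof (cases "i < j")
    case True
    then show ?thesis using lt ij(2) by blast
  next
    case False
    then have "j < i" using ij by simp
    then have R: "R j i" using upper[of j i] ij by simp
    \<comment> \<open>If \<open>(i, j)\<close> and \<open>(j, i)\<close> were of different kinds,
      the sum in \<open>pair\<close> would be 0 instead of 1.\<close>
    have "c i j \<noteq> 0 \<longleftrightarrow> c j i \<noteq> 0"
      using pair[OF ij R] xor[OF ij] xor[of j i] ij R by auto
    then show ?thesis using lt[OF \<open>j < i\<close> ij(1)] by blast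
  qed
  show ?thesis
    using all xor by blast
qed

text \<open>Index 0 is related to every index and serves as base point: the cocycle identity for
  \<open>0, i, j\<close> reads \<open>g j = g i * c i j\<close> with
  \<open>g i = c 0 i\<close>.\<close>

lemma cocycle_coboundary:
  fixes c :: "nat \<Rightarrow> nat \<Rightarrow> 'a :: field"
  assumes upper: "\<And>i j. i \<le> j \<Longrightarrow> j < n \<Longrightarrow> R i j"
    and nz: "\<And>i j. i < n \<Longrightarrow> j < n \<Longrightarrow> i \<noteq> j \<Longrightarrow> R i j \<Longrightarrow> c i j \<noteq> 0"
    and trip: "\<And>i j k. i < n \<Longrightarrow> j < n \<Longrightarrow> k < n \<Longrightarrow> i \<noteq> j \<Longrightarrow> j \<noteq> k \<Longrightarrow> i \<noteq> k \<Longrightarrow> R i j \<Longrightarrow> R j k \<Longrightarrow>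
        c i k = c i j * c j k"
    and pair: "\<And>i j. i < n \<Longrightarrow> j < n \<Longrightarrow> i \<noteq> j \<Longrightarrow> R i j \<Longrightarrow> R j i \<Longrightarrow> c i j * c j i = 1"
  obtains g where "\<And>i. i < n \<Longrightarrow> g i \<noteq> 0"
    "\<And>i j. i < n \<Longrightarrow> j < n \<Longrightarrow> i \<noteq> j \<Longrightarrow> R i j \<Longrightarrow> c i j = g j / g i"
proof
  \<comment> \<open>The diagonal value \<open>c 0 0\<close> is unconstrained, so \<open>g 0\<close>
    is set to 1 separately. For \<open>j = 0\<close> the identity needed below is then the one in
    \<open>pair\<close>.\<close>
  define g where "g i = (if i = 0 then 1 else c 0 i)" for i
  show g0: "g i \<noteq> 0" if "i < n" for i
    using nz[of 0 i] upper[of 0 i] that by (auto simp: g_def)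
  show "c i j = g j / g i" if ij: "i < n" "j < n" "i \<noteq> j" "R i j" for i j
  proof -
    have "g i * c i j = g j"
    proof (cases "i = 0")
      case i: False
      have R: "R 0 i" using upper[of 0 i] ij by simp
      show ?thesis
        using trip[of 0 i j] pair[of 0 i] R ij i by (cases "j = 0") (auto simp: g_def)
    qed (use ij in \<open>simp add: g_def\<close>)
    then show ?thesis using g0[OF ij(1)] by (simp add: field_simps)
  qed
qed

section \<open>Embeddings that fix the diagonal units\<close>

text \<open>Here \<open>M = c E_ij + d E_ji\<close>, the shape that the image of an off-diagonal
  unit turns out to have.\<close>

lemma two_entry_mult_index:
  fixes M :: "'a :: semiring_1 mat"
  assumes M: "M \<in> carrier_mat n n" and X: "X \<in> carrier_mat n n"
    and entries: "\<And>a b. a < n \<Longrightarrow> b < n \<Longrightarrow>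
      M $$ (a, b) = (if a = i \<and> b = j then c else if a = j \<and> b = i then d else 0)"
    and ij: "i < n" "j < n" "i \<noteq> j" and ab: "a < n" "b < n"
  shows "(M * X) $$ (a, b) = (if a = i then c * X $$ (j, b) else if a = j then d * X $$ (i, b) else 0)"
proof -
  have "(M * X) $$ (a, b) = (\<Sum>k<n. if k = (if a = i then j else i) then
      (if a = i then c * X $$ (j, b) else if a = j then d * X $$ (i, b) else 0) else 0)"
    unfolding mult_mat_index[OF M X ab]
    by (rule sum.cong) (use entries ab ij in auto)
  also have "\<dots> = (if a = i then c * X $$ (j, b) else if a = j then d * X $$ (i, b) else 0)"
    using ij by (subst sum.delta) auto
  finally show ?thesis .
qed

definition diag_of :: "nat \<Rightarrow> (nat \<Rightarrow> 'a :: semiring_1) \<Rightarrow> 'a mat" where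
  "diag_of n g = mat n n (\<lambda>(i, j). if i = j then g i else 0)"

lemma diag_of_carrier [simp]: "diag_of n g \<in> carrier_mat n n"
  by (simp add: diag_of_def)

lemma diag_of_inverse:
  fixes g :: "nat \<Rightarrow> 'a :: field"
  assumes "\<And>i. i < n \<Longrightarrow> g i \<noteq> 0"
  shows "diag_of n g * diag_of n (\<lambda>i. 1 / g i) = 1\<^sub>m n"
proof (rule eq_matI)
  fix a b assume "a < dim_row (1\<^sub>m n :: 'a mat)" "b < dim_col (1\<^sub>m n :: 'a mat)"
  then have ab: "a < n" "b < n" by auto
  have "(diag_of n g * diag_of n (\<lambda>i. 1 / g i)) $$ (a, b) =
      (\<Sum>k<n. if k = a then (if a = b then 1 else 0) else 0)"
    unfolding mult_mat_index[OF diag_of_carrier diag_of_carrier ab]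
    by (rule sum.cong) (use ab assms in \<open>auto simp: diag_of_def\<close>)
  then show "(diag_of n g * diag_of n (\<lambda>i. 1 / g i)) $$ (a, b) = 1\<^sub>m n $$ (a, b)"
    using ab by simp
qed (auto simp: diag_of_def)

text \<open>With \<open>h = 1 / g\<close> the scalar is \<open>g i / g j\<close>, so conjugation by
  a diagonal matrix can absorb a coboundary.\<close>

lemma diag_of_conj_mat_unit:
  assumes "i < n" "j < n"
  shows "diag_of n g * mat_unit n i j * diag_of n h = (g i * h j) \<cdot>\<^sub>m mat_unit n i j"
proof (rule eq_matI)
  fix a b assume "a < dim_row ((g i * h j) \<cdot>\<^sub>m mat_unit n i j)" "b < dim_col ((g i * h j) \<cdot>\<^sub>m mat_unit n i j)"
  then have ab: "a < n" "b < n" by auto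
  show "(diag_of n g * mat_unit n i j * diag_of n h) $$ (a, b) = ((g i * h j) \<cdot>\<^sub>m mat_unit n i j) $$ (a, b)"
    unfolding conj_mat_unit_index[OF diag_of_carrier diag_of_carrier ab assms]
    using ab assms by (auto simp: diag_of_def)
qed (auto simp: diag_of_def)

lemma linear_on_mats_conj:
  assumes A: "A \<subseteq> carrier_mat n n" and D: "D \<in> carrier_mat n n" "D' \<in> carrier_mat n n"
    and f: "linear_on_mats A f" "f ` A \<subseteq> carrier_mat n n"
  shows "linear_on_mats A (\<lambda>X. D * f X * D')"
  unfolding linear_on_mats_def
proof (intro conjI ballI allI)
  fix X Y assume XY: "X \<in> A" "Y \<in> A"
  then have c: "f X \<in> carrier_mat n n" "f Y \<in> carrier_mat n n" using f by auto
  have "f (X + Y) = f X + f Y" using f XY unfolding linear_on_mats_def by blast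
  then show "D * f (X + Y) * D' = D * f X * D' + D * f Y * D'"
    using mult_add_distrib_mat[OF D(1) c]
      add_mult_distrib_mat[OF mult_carrier_mat[OF D(1) c(1)] mult_carrier_mat[OF D(1) c(2)] D(2)]
    by simp
next
  fix k X assume X: "X \<in> A"
  then have c: "f X \<in> carrier_mat n n" using f by auto
  have "f (k \<cdot>\<^sub>m X) = k \<cdot>\<^sub>m f X" using f X unfolding linear_on_mats_def by blast
  then show "D * f (k \<cdot>\<^sub>m X) * D' = k \<cdot>\<^sub>m (D * f X * D')"
    using mult_smult_distrib[OF D(1) c] mult_smult_assoc_mat[OF mult_carrier_mat[OF D(1) c] D(2)]
    by simp
qed

lemma linear_on_mats_id: "linear_on_mats A (\<lambda>X. X)"
  by (simp add: linear_on_mats_def)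

lemma linear_on_mats_transpose:
  assumes "A \<subseteq> carrier_mat n n"
  shows "linear_on_mats A transpose_mat"
  unfolding linear_on_mats_def using assms
  by (auto intro!: transpose_add[where nr = n and nc = n] eq_matI)

lemma jordan_hom_linear: "jordan_hom A C \<phi> \<Longrightarrow> linear_on_mats A \<phi>"
  unfolding jordan_hom_def linear_on_mats_def by simp

text \<open>The Jordan relations among units turn into the hypotheses of
  \<open>cocycle_dichotomy\<close> for the coefficients \<open>c\<close> and \<open>d\<close>. The
  surviving family is a coboundary, and it supplies a diagonal \<open>D\<close> with inverse
  \<open>D'\<close>.\<close>

lemma jordan_embedding_fixing_diag:
  assumes A: "block_upper_triangular_algebra n A"
    and \<phi>: "jordan_embedding A (carrier_mat n n) \<phi>"
    and diag: "\<And>i. i < n \<Longrightarrow> \<phi> (mat_unit n i i) = mat_unit n i i"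
  obtains D D' where "D \<in> carrier_mat n n" "D' \<in> carrier_mat n n" "D * D' = 1\<^sub>m n"
    "(\<forall>X\<in>A. \<phi> X = D * X * D') \<or> (\<forall>X\<in>A. \<phi> X = D * transpose_mat X * D')"
proof -
  note result = that
  define R where "R i j \<longleftrightarrow> mat_unit n i j \<in> A" for i j
  define c where "c i j = \<phi> (mat_unit n i j) $$ (i, j)" for i j
  define d where "d i j = \<phi> (mat_unit n i j) $$ (j, i)" for i j
  have Ac: "A \<subseteq> carrier_mat n n" and zA: "0\<^sub>m n n \<in> A"
    using A unfolding block_upper_triangular_algebra_def matrix_subalgebra_def by auto
  have car: "\<phi> X \<in> carrier_mat n n" if "X \<in> A" for X
    using \<phi> that unfolding jordan_embedding_def jordan_hom_def by auto
  have lin: "linear_on_mats A \<phi>"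
    using \<phi> jordan_hom_linear unfolding jordan_embedding_def by blast
  have jord: "\<phi> (jordan_prod X Y) = \<phi> X * \<phi> Y + \<phi> Y * \<phi> X" if "X \<in> A" "Y \<in> A" for X Y
    using \<phi> that unfolding jordan_embedding_def jordan_hom_def by (auto simp: jordan_prod_def)
  have inj: "inj_on \<phi> A" using \<phi> unfolding jordan_embedding_def by blast
  have upper: "R i j" if "i \<le> j" "j < n" for i j
    using mat_unit_mem_upper[OF A that] by (simp add: R_def)
  have trans: "R i k" if "j < n" "R i j" "R j k" for i j k
    using mat_unit_mem_trans[OF A] that by (simp add: R_def)
  have zero: "\<phi> (0\<^sub>m n n) = 0\<^sub>m n n"
    using linear_on_mats_zero[OF lin zA car[OF zA]] .
  have entries: "\<phi> (mat_unit n i j) $$ (a, b) =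
      (if a = i \<and> b = j then c i j else if a = j \<and> b = i then d i j else 0)"
    if ij: "i < n" "j < n" "i \<noteq> j" "R i j" and ab: "a < n" "b < n" for i j a b
  proof -
    let ?M = "\<phi> (mat_unit n i j)"
    have M: "?M \<in> carrier_mat n n" using car ij by (simp add: R_def)
    have "?M = mat_unit n k k * ?M + ?M * mat_unit n k k" if k: "k = i \<or> k = j" for k
    proof -
      have kn: "k < n" using k ij by auto
      have "jordan_prod (mat_unit n k k) (mat_unit n i j) = (mat_unit n i j :: complex mat)"
        using k ij by (auto simp: jordan_prod_def mat_unit_mult_mat_unit)
      then show ?thesis
        using jord[of "mat_unit n k k" "mat_unit n i j"] upper[of k k] diag[OF kn] ij kn by (simp add: R_def)
    qed
    then have "?M $$ (a, b) = (mat_unit n k k * ?M + ?M * mat_unit n k k) $$ (a, b)" if "k = i \<or> k = j" for k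
      using that by simp
    \<comment> \<open>An entry survives only if exactly one of \<open>a\<close>, \<open>b\<close> is
      \<open>k\<close>: if both are, it equals twice itself; if neither is, it is 0. Taking
      \<open>k = i\<close> and \<open>k = j\<close> leaves the positions \<open>(i, j)\<close> and
      \<open>(j, i)\<close>.\<close>
    then have eq: "?M $$ (a, b) = (if a = k then ?M $$ (k, b) else 0) + (if b = k then ?M $$ (a, k) else 0)"
      if "k = i \<or> k = j" for k
      using that M ab ij mat_unit_mult_index[OF M ab, of k k] mult_mat_unit_index[OF M ab, of k k]
      by (auto simp del: index_mult_mat(1))
    show ?thesis
      using eq[of i] eq[of j] ij by (auto simp: c_def d_def split: if_splits)
  qed
  have prod: "(\<phi> (mat_unit n i j) * \<phi> (mat_unit n k l)) $$ (a, b) =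
      (if a = i then c i j * \<phi> (mat_unit n k l) $$ (j, b)
       else if a = j then d i j * \<phi> (mat_unit n k l) $$ (i, b) else 0)"
    if "i < n" "j < n" "i \<noteq> j" "R i j" "R k l" "a < n" "b < n" for i j k l a b
    by (rule two_entry_mult_index[where n = n]) (use that entries car in \<open>auto simp: R_def\<close>)
  have jord_index: "\<phi> (jordan_prod (mat_unit n i j) (mat_unit n k l)) $$ (a, b) =
      (\<phi> (mat_unit n i j) * \<phi> (mat_unit n k l)) $$ (a, b) + (\<phi> (mat_unit n k l) * \<phi> (mat_unit n i j)) $$ (a, b)"
    if "R i j" "R k l" "a < n" "b < n" for i j k l a b
    using jord[of "mat_unit n i j" "mat_unit n k l"] that car[of "mat_unit n i j"] car[of "mat_unit n k l"]
    by (simp add: R_def del: index_mult_mat(1))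
  have excl: "c i j * d i j = 0" if ij: "i < n" "j < n" "i \<noteq> j" "R i j" for i j
  proof -
    \<comment> \<open>\<open>E_ij\<close> squares to zero; the image of this relation is read at
      position \<open>(i, i)\<close>.\<close>
    have "jordan_prod (mat_unit n i j) (mat_unit n i j) = (0\<^sub>m n n :: complex mat)"
      using ij by (simp add: jordan_prod_def mat_unit_mult_mat_unit)
    then have "0 = c i j * d i j + c i j * d i j"
      using jord_index[OF ij(4,4,1,1)] prod[OF ij(1-4,4,1,1)] zero ij entries[OF ij ij(2,1)] by simp
    then show ?thesis by simp
  qed
  have nz: "c i j \<noteq> 0 \<or> d i j \<noteq> 0" if ij: "i < n" "j < n" "i \<noteq> j" "R i j" for i j
  proof (rule ccontr)
    assume "\<not> ?thesis"
    \<comment> \<open>Injectivity is what excludes that both coefficients vanish.\<close>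
    then have "\<phi> (mat_unit n i j) = \<phi> (0\<^sub>m n n)"
      unfolding zero by (intro eq_matI) (use entries[OF ij] car[of "mat_unit n i j"] ij in \<open>auto simp: R_def\<close>)
    then have "mat_unit n i j = (0\<^sub>m n n :: complex mat)"
      using inj zA ij by (auto simp: R_def dest: inj_onD)
    then have "mat_unit n i j $$ (i, j) = (0\<^sub>m n n $$ (i, j) :: complex)" by simp
    then show False using ij by simp
  qed
  have trip: "c i k = c i j * c j k \<and> d i k = d i j * d j k"
    if ijk: "i < n" "j < n" "k < n" "i \<noteq> j" "j \<noteq> k" "i \<noteq> k" "R i j" "R j k" for i j k
  proof -
    have "jordan_prod (mat_unit n i j) (mat_unit n j k) = (mat_unit n i k :: complex mat)"
      using ijk by (simp add: jordan_prod_def mat_unit_mult_mat_unit)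
    then have "\<phi> (mat_unit n i k) $$ (a, b) =
        (\<phi> (mat_unit n i j) * \<phi> (mat_unit n j k)) $$ (a, b) + (\<phi> (mat_unit n j k) * \<phi> (mat_unit n i j)) $$ (a, b)"
      if "a < n" "b < n" for a b
      using jord_index[OF ijk(7,8) that] by simp
    \<comment> \<open>At \<open>(i, k)\<close> only the first product contributes, giving
      \<open>c i j * c j k\<close>; at \<open>(k, i)\<close> only the second, giving
      \<open>d j k * d i j\<close>.\<close>
    from this[of i k] this[of k i] show ?thesis
      using ijk prod[of i j j k] prod[of j k i j] entries[of i j] entries[of j k] trans[OF ijk(2,7,8)]
      by (simp add: c_def[of i k] d_def[of i k] mult.commute)
  qed
  have pair: "c i j * c j i + d i j * d j i = 1"
    if ij: "i < n" "j < n" "i \<noteq> j" "R i j" "R j i" for i j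
  proof -
    have "jordan_prod (mat_unit n i j) (mat_unit n j i) = (mat_unit n i i + mat_unit n j j :: complex mat)"
      using ij by (simp add: jordan_prod_def mat_unit_mult_mat_unit)
    moreover have "\<phi> (mat_unit n i i + mat_unit n j j) = mat_unit n i i + mat_unit n j j"
      using lin diag ij upper[of i i] upper[of j j] unfolding linear_on_mats_def R_def by simp
    \<comment> \<open>The relation is read at \<open>(i, i)\<close>, where the fixed matrix
      \<open>E_ii + E_jj\<close> has entry 1.\<close>
    ultimately show ?thesis
      using jord_index[OF ij(4,5,1,1)] prod[of i j j i i i] prod[of j i i j i i] ij
        entries[of i j] entries[of j i]
      by (simp add: mult.commute)
  qed
  have unit_eq: "\<phi> (mat_unit n i j) = c i j \<cdot>\<^sub>m mat_unit n i j"
    if "i < n" "j < n" "i \<noteq> j" "R i j" "d i j = 0" for i j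
    by (rule eq_matI) (use entries[OF that(1-4)] that car[of "mat_unit n i j"] in \<open>auto simp: R_def\<close>)
  have unit_eq': "\<phi> (mat_unit n i j) = d i j \<cdot>\<^sub>m mat_unit n j i"
    if "i < n" "j < n" "i \<noteq> j" "R i j" "c i j = 0" for i j
    by (rule eq_matI) (use entries[OF that(1-4)] that car[of "mat_unit n i j"] in \<open>auto simp: R_def\<close>)
  have smult_one: "1 \<cdot>\<^sub>m X = X" for X :: "complex mat" by (rule eq_matI) auto
  \<comment> \<open>Both alternatives end in the same way, with \<open>f\<close> the identity or the
    transpose: agreement on units extends to \<open>A\<close> by linearity.\<close>
  have concl: thesis
    if nzg: "\<And>i. i < n \<Longrightarrow> g i \<noteq> 0" and lf: "linear_on_mats A f" "f ` A \<subseteq> carrier_mat n n"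
      and f: "f = (\<lambda>X. X) \<or> f = transpose_mat"
      and eq: "\<And>i j. i < n \<Longrightarrow> j < n \<Longrightarrow> R i j \<Longrightarrow>
        \<phi> (mat_unit n i j) = diag_of n g * f (mat_unit n i j) * diag_of n (\<lambda>i. 1 / g i)" for g f
  proof (rule result[OF diag_of_carrier diag_of_carrier])
    show "diag_of n g * diag_of n (\<lambda>i. 1 / g i) = 1\<^sub>m n" by (rule diag_of_inverse) (rule nzg)
    have "\<phi> X = diag_of n g * f X * diag_of n (\<lambda>i. 1 / g i)" if "X \<in> A" for X
      by (rule linear_on_mats_eqI[OF A lin linear_on_mats_conj[OF Ac _ _ lf]])
        (use that eq car[OF zA] zA lf in \<open>auto simp: R_def intro!: mult_carrier_mat[where n = n]\<close>)
    then show "(\<forall>X\<in>A. \<phi> X = diag_of n g * X * diag_of n (\<lambda>i. 1 / g i)) \<or>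
        (\<forall>X\<in>A. \<phi> X = diag_of n g * transpose_mat X * diag_of n (\<lambda>i. 1 / g i))"
      using f by auto
  qed
  from cocycle_dichotomy[where R = R and c = c and d = d, OF upper trans excl nz trip pair]
  show thesis
  proof
    assume c: "\<forall>i<n. \<forall>j<n. i \<noteq> j \<longrightarrow> R i j \<longrightarrow> d i j = 0 \<and> c i j \<noteq> 0"
    have nz': "c i j \<noteq> 0" if "i < n" "j < n" "i \<noteq> j" "R i j" for i j
      using c that by simp
    have trip': "c i k = c i j * c j k"
      if "i < n" "j < n" "k < n" "i \<noteq> j" "j \<noteq> k" "i \<noteq> k" "R i j" "R j k" for i j k
      using trip[OF that] by simp
    have pair': "c i j * c j i = 1" if "i < n" "j < n" "i \<noteq> j" "R i j" "R j i" for i j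
      using pair[OF that] c that by simp
    obtain g where g: "\<And>i. i < n \<Longrightarrow> g i \<noteq> 0"
      and cg: "\<And>i j. i < n \<Longrightarrow> j < n \<Longrightarrow> i \<noteq> j \<Longrightarrow> R i j \<Longrightarrow> c i j = g j / g i"
      using cocycle_coboundary[where R = R and c = c and n = n, OF upper nz' trip' pair'] by blast
    show thesis
    \<comment> \<open>Conjugation by \<open>diag_of n h\<close> scales \<open>E_ij\<close> by
      \<open>h i / h j\<close>, while \<open>c i j = g j / g i\<close>; hence
      \<open>h = 1 / g\<close>.\<close>
    proof (rule concl[where g = "\<lambda>i. 1 / g i" and f = "\<lambda>X. X"])
      fix i j assume "i < n" "j < n" "R i j"
      then show "\<phi> (mat_unit n i j) =
          diag_of n (\<lambda>i. 1 / g i) * mat_unit n i j * diag_of n (\<lambda>i. 1 / (1 / g i))"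
        using unit_eq[of i j] cg[of i j] c g[of i] diag[of i]
        by (cases "i = j") (auto simp: diag_of_conj_mat_unit smult_one)
    qed (use g Ac in \<open>auto simp: linear_on_mats_id\<close>)
  next
    assume d: "\<forall>i<n. \<forall>j<n. i \<noteq> j \<longrightarrow> R i j \<longrightarrow> c i j = 0 \<and> d i j \<noteq> 0"
    have nz': "d i j \<noteq> 0" if "i < n" "j < n" "i \<noteq> j" "R i j" for i j
      using d that by simp
    have trip': "d i k = d i j * d j k"
      if "i < n" "j < n" "k < n" "i \<noteq> j" "j \<noteq> k" "i \<noteq> k" "R i j" "R j k" for i j k
      using trip[OF that] by simp
    have pair': "d i j * d j i = 1" if "i < n" "j < n" "i \<noteq> j" "R i j" "R j i" for i j
      using pair[OF that] d that by simp
    obtain g where g: "\<And>i. i < n \<Longrightarrow> g i \<noteq> 0"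
      and dg: "\<And>i j. i < n \<Longrightarrow> j < n \<Longrightarrow> i \<noteq> j \<Longrightarrow> R i j \<Longrightarrow> d i j = g j / g i"
      using cocycle_coboundary[where R = R and c = d and n = n, OF upper nz' trip' pair'] by blast
    show thesis
    \<comment> \<open>The transpose moves \<open>E_ij\<close> to \<open>E_ji\<close>, which
      \<open>diag_of n g\<close> scales by \<open>g j / g i = d i j\<close>, so \<open>g\<close> is
      not inverted here.\<close>
    proof (rule concl[where g = g and f = transpose_mat])
      fix i j assume "i < n" "j < n" "R i j"
      then show "\<phi> (mat_unit n i j) =
          diag_of n g * transpose_mat (mat_unit n i j) * diag_of n (\<lambda>i. 1 / g i)"
        using unit_eq'[of i j] dg[of i j] d g[of i] diag[of i]
        by (cases "i = j") (auto simp: diag_of_conj_mat_unit smult_one transpose_mat_unit)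
    qed (use g Ac linear_on_mats_transpose[OF Ac] in auto)
  qed
qed

section \<open>General form of a Jordan embedding\<close>

text \<open>Stated with dimension premises that the simplifier can discharge, so that long products
  are re-bracketed by rewriting.\<close>

lemma mult_assoc_dim:
  "dim_col A = dim_row B \<Longrightarrow> dim_col B = dim_row C \<Longrightarrow> A * B * C = A * (B * (C :: 'a :: semiring_0 mat))"
  by (rule assoc_mult_mat) auto

lemma conj_mult:
  fixes X Y S T :: "'a :: semiring_1 mat"
  assumes carr: "X \<in> carrier_mat n n" "Y \<in> carrier_mat n n" "S \<in> carrier_mat n n" "T \<in> carrier_mat n n"
    and TS: "T * S = 1\<^sub>m n"
  shows "S * X * T * (S * Y * T) = S * (X * Y) * T"
proof -
  have "S * X * T * (S * Y * T) = S * X * (T * S) * (Y * T)"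
    by (simp add: mult_assoc_dim carr[THEN carrier_matD(1)] carr[THEN carrier_matD(2)])
  then show ?thesis
    using carr by (simp add: TS mult_assoc_dim carr[THEN carrier_matD(1)] carr[THEN carrier_matD(2)])
qed

lemma conj_cancel:
  fixes X S T :: "'a :: semiring_1 mat"
  assumes carr: "X \<in> carrier_mat n n" "S \<in> carrier_mat n n" "T \<in> carrier_mat n n"
    and TS: "T * S = 1\<^sub>m n"
  shows "T * (S * X * T) * S = X"
proof -
  have "T * (S * X * T) * S = (T * S) * X * (T * S)"
    by (simp add: mult_assoc_dim carr[THEN carrier_matD(1)] carr[THEN carrier_matD(2)])
  then show ?thesis using carr by (simp add: TS)
qed

text \<open>This permits the reduction to embeddings that fix the diagonal units.\<close>

lemma jordan_embedding_conj:
  assumes A: "A \<subseteq> carrier_mat n n" "\<And>X Y. X \<in> A \<Longrightarrow> Y \<in> A \<Longrightarrow> jordan_prod X Y \<in> A"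
    and \<phi>: "jordan_embedding A (carrier_mat n n) \<phi>"
    and T: "T \<in> carrier_mat n n" and S: "S \<in> carrier_mat n n" and TS: "T * S = 1\<^sub>m n"
  shows "jordan_embedding A (carrier_mat n n) (\<lambda>X. S * \<phi> X * T)"
proof -
  have car: "\<phi> X \<in> carrier_mat n n" if "X \<in> A" for X
    using \<phi> that unfolding jordan_embedding_def jordan_hom_def by auto
  have "linear_on_mats A (\<lambda>X. S * \<phi> X * T)"
    using \<phi> car by (intro linear_on_mats_conj[OF A(1) S T])
      (auto simp: jordan_embedding_def intro: jordan_hom_linear)
  moreover have "S * \<phi> (jordan_prod X Y) * T = jordan_prod (S * \<phi> X * T) (S * \<phi> Y * T)"
    if XY: "X \<in> A" "Y \<in> A" for X Y
  proof -
    note c = car[OF XY(1)] car[OF XY(2)]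
    have xy: "\<phi> X * \<phi> Y \<in> carrier_mat n n" "\<phi> Y * \<phi> X \<in> carrier_mat n n" using c by auto
    have "\<phi> (jordan_prod X Y) = \<phi> X * \<phi> Y + \<phi> Y * \<phi> X"
      using \<phi> XY unfolding jordan_embedding_def jordan_hom_def by (auto simp: jordan_prod_def)
    then have "S * \<phi> (jordan_prod X Y) * T = S * (\<phi> X * \<phi> Y) * T + S * (\<phi> Y * \<phi> X) * T"
      using mult_add_distrib_mat[OF S xy]
        add_mult_distrib_mat[OF mult_carrier_mat[OF S xy(1)] mult_carrier_mat[OF S xy(2)] T] by simp
    then show ?thesis
      using conj_mult[OF c S T TS] conj_mult[OF c(2,1) S T TS] by (simp add: jordan_prod_def)
  qed
  moreover have "inj_on (\<lambda>X. S * \<phi> X * T) A"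
  proof (rule inj_onI)
    fix X Y assume XY: "X \<in> A" "Y \<in> A" "S * \<phi> X * T = S * \<phi> Y * T"
    have "\<phi> X = T * (S * \<phi> X * T) * S"
      using conj_cancel[OF car[OF XY(1)] S T TS] by (rule sym)
    also have "\<dots> = T * (S * \<phi> Y * T) * S" by (simp only: XY(3))
    also have "\<dots> = \<phi> Y" by (rule conj_cancel[OF car[OF XY(2)] S T TS])
    finally have "\<phi> X = \<phi> Y" .
    then show "X = Y" using \<phi> XY unfolding jordan_embedding_def by (auto dest: inj_onD)
  qed
  ultimately show ?thesis
    using car S T unfolding jordan_embedding_def jordan_hom_def linear_on_mats_def
    by (auto intro!: mult_carrier_mat[where n = n])
qed

lemma jordan_embedding_form:
  assumes A: "block_upper_triangular_algebra n A"
    and \<phi>: "jordan_embedding A (carrier_mat n n) \<phi>"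
  obtains U V where "U \<in> carrier_mat n n" "V \<in> carrier_mat n n" "U * V = 1\<^sub>m n"
    "(\<forall>X\<in>A. \<phi> X = U * X * V) \<or> (\<forall>X\<in>A. \<phi> X = U * transpose_mat X * V)"
proof -
  have Ac: "A \<subseteq> carrier_mat n n" and zA: "0\<^sub>m n n \<in> A"
    and Aj: "\<And>X Y. X \<in> A \<Longrightarrow> Y \<in> A \<Longrightarrow> jordan_prod X Y \<in> A"
    using A unfolding block_upper_triangular_algebra_def matrix_subalgebra_def jordan_prod_def by auto
  have car: "\<phi> X \<in> carrier_mat n n" if "X \<in> A" for X
    using \<phi> that unfolding jordan_embedding_def jordan_hom_def by auto
  have jord: "\<phi> (jordan_prod X Y) = jordan_prod (\<phi> X) (\<phi> Y)" if "X \<in> A" "Y \<in> A" for X Y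
    using \<phi> that unfolding jordan_embedding_def jordan_hom_def by auto
  have lin: "linear_on_mats A \<phi>"
    using \<phi> jordan_hom_linear unfolding jordan_embedding_def by blast
  have add: "\<phi> (X + Y) = \<phi> X + \<phi> Y" if "X \<in> A" "Y \<in> A" for X Y
    using \<phi> that unfolding jordan_embedding_def jordan_hom_def by auto
  have inj: "inj_on \<phi> A" using \<phi> unfolding jordan_embedding_def by blast
  have zero: "\<phi> (0\<^sub>m n n) = 0\<^sub>m n n"
    using linear_on_mats_zero[OF lin zA car[OF zA]] .
  have diag: "mat_unit n i i \<in> A" if "i < n" for i
    using mat_unit_mem_upper[OF A] that by simp
  have idem: "\<phi> (mat_unit n i i) * \<phi> (mat_unit n i i) = \<phi> (mat_unit n i i)" if i: "i < n" for i
  proof -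
    let ?P = "\<phi> (mat_unit n i i)"
    \<comment> \<open>The Jordan square of \<open>E_ii\<close> is \<open>2 E_ii\<close>, so the
      relation comes with a factor 2, which is cancelled entrywise.\<close>
    have "?P * ?P + ?P * ?P = ?P + ?P"
      using jord[OF diag[OF i] diag[OF i]] add[OF diag[OF i] diag[OF i]] i
      by (simp add: jordan_prod_def mat_unit_mult_mat_unit)
    then have sum: "(?P * ?P + ?P * ?P) $$ (a, b) = (?P + ?P) $$ (a, b)" for a b by simp
    have "(?P * ?P) $$ (a, b) = ?P $$ (a, b)" if "a < n" "b < n" for a b
      using sum[of a b] that carrier_matD[OF car[OF diag[OF i]]] by (simp del: index_mult_mat(1))
    then show ?thesis
      using car[OF diag[OF i]] by (intro eq_matI) (auto simp del: index_mult_mat(1))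
  qed
  have orth: "\<phi> (mat_unit n i i) * \<phi> (mat_unit n j j) = 0\<^sub>m n n" if ij: "i < n" "j < n" "i \<noteq> j" for i j
  proof (rule jordan_orthogonal_idempotents)
    have "jordan_prod (mat_unit n i i) (mat_unit n j j) = (0\<^sub>m n n :: complex mat)"
      using ij by (simp add: jordan_prod_def mat_unit_mult_mat_unit)
    then show "jordan_prod (\<phi> (mat_unit n i i)) (\<phi> (mat_unit n j j)) = 0\<^sub>m n n"
      using jord[OF diag[OF ij(1)] diag[OF ij(2)]] zero by simp
  qed (use car diag idem ij in auto)
  have nz: "\<phi> (mat_unit n i i) \<noteq> 0\<^sub>m n n" if i: "i < n" for i
  proof
    assume "\<phi> (mat_unit n i i) = 0\<^sub>m n n"
    then have "mat_unit n i i = (0\<^sub>m n n :: complex mat)"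
      using inj zA diag[OF i] zero by (metis inj_onD)
    then have "mat_unit n i i $$ (i, i) = (0\<^sub>m n n $$ (i, i) :: complex)" by simp
    then show False using i by simp
  qed
  obtain T S where T: "T \<in> carrier_mat n n" and S: "S \<in> carrier_mat n n"
    and TS: "T * S = 1\<^sub>m n" "S * T = 1\<^sub>m n"
    and fix_diag: "\<And>i. i < n \<Longrightarrow> S * \<phi> (mat_unit n i i) * T = mat_unit n i i"
    using orthogonal_idempotents_diagonalize[where P = "\<lambda>i. \<phi> (mat_unit n i i)",
        OF car[OF diag] idem orth nz] by blast
  obtain D D' where D: "D \<in> carrier_mat n n" and D': "D' \<in> carrier_mat n n" and DD': "D * D' = 1\<^sub>m n"
    and form: "(\<forall>X\<in>A. S * \<phi> X * T = D * X * D') \<or> (\<forall>X\<in>A. S * \<phi> X * T = D * transpose_mat X * D')"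
    using jordan_embedding_fixing_diag[OF A jordan_embedding_conj[OF Ac Aj \<phi> T S TS(1)] fix_diag] by blast
  \<comment> \<open>Undoing the conjugation by \<open>T\<close> turns \<open>D\<close> and
    \<open>D'\<close> into \<open>T * D\<close> and \<open>D' * S\<close>, the witnesses for
    \<open>U\<close> and \<open>V\<close>.\<close>
  have "T * D * (D' * S) = T * (D * D') * S"
    using carrier_matD[OF T] carrier_matD[OF S] carrier_matD[OF D] carrier_matD[OF D']
    by (simp add: mult_assoc_dim)
  then have "T * D * (D' * S) = 1\<^sub>m n" using T TS DD' by simp
  moreover have "\<phi> X = T * D * Y * (D' * S)"
    if "X \<in> A" "S * \<phi> X * T = D * Y * D'" "Y \<in> carrier_mat n n" for X Y
  proof -
    have "\<phi> X = T * (D * Y * D') * S"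
      using conj_cancel[OF car[OF that(1)] S T TS(1)] that(2) by simp
    then show ?thesis
      using carrier_matD[OF T] carrier_matD[OF S] carrier_matD[OF D] carrier_matD[OF D'] carrier_matD[OF that(3)]
      by (simp add: mult_assoc_dim)
  qed
  then have "(\<forall>X\<in>A. \<phi> X = T * D * X * (D' * S)) \<or> (\<forall>X\<in>A. \<phi> X = T * D * transpose_mat X * (D' * S))"
    using form Ac by (meson subsetD transpose_carrier_mat)
  ultimately show thesis using T S D D' by (intro that[of "T * D" "D' * S"]) auto
qed

section \<open>Inverses and reflection in the antidiagonal\<close>

lemma mat_inv_eqI:
  assumes T: "T \<in> carrier_mat n n" and S: "S \<in> carrier_mat n n" and TS: "T * S = 1\<^sub>m n"
  shows "mat_inv T = S"
proof -
  have ST: "S * T = 1\<^sub>m n" using mat_mult_left_right_inverse[OF T S TS] .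
  have "T \<in> Units (ring_mat TYPE(complex) n ())"
    using T S TS ST by (auto simp: Units_def ring_mat_def)
  then obtain R where R: "mat_inverse T = Some R"
    using mat_inverse(1)[OF T] by fastforce
  then have "R * T = 1\<^sub>m n" "R \<in> carrier_mat n n" using mat_inverse(2)[OF T] by auto
  then have "R = R * (T * S)" using TS by simp
  also have "\<dots> = (R * T) * S" using \<open>R \<in> _\<close> T S by simp
  also have "\<dots> = S" using \<open>R * T = _\<close> S by simp
  finally show ?thesis using R by (simp add: mat_inv_def)
qed

lemma exchange_mat_carrier [simp]: "exchange_mat n \<in> carrier_mat n n"
  by (simp add: exchange_mat_def)

lemma exchange_mat_mult_index:
  assumes X: "X \<in> carrier_mat n n" and ab: "a < n" "b < n"
  shows "(exchange_mat n * X) $$ (a, b) = X $$ (n - Suc a, b)"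
proof -
  have "(exchange_mat n * X) $$ (a, b) = (\<Sum>k<n. if k = n - Suc a then X $$ (k, b) else 0)"
    unfolding mult_mat_index[OF exchange_mat_carrier X ab]
    by (rule sum.cong) (use ab in \<open>auto simp: exchange_mat_def\<close>)
  then show ?thesis using ab by simp
qed

lemma mult_exchange_mat_index:
  assumes X: "X \<in> carrier_mat n n" and ab: "a < n" "b < n"
  shows "(X * exchange_mat n) $$ (a, b) = X $$ (a, n - Suc b)"
proof -
  have "(X * exchange_mat n) $$ (a, b) = (\<Sum>k<n. if k = n - Suc b then X $$ (a, k) else 0)"
    unfolding mult_mat_index[OF X exchange_mat_carrier ab]
    by (rule sum.cong) (use ab in \<open>auto simp: exchange_mat_def\<close>)
  then show ?thesis using ab by simp
qed

lemma exchange_mat_involution: "exchange_mat n * exchange_mat n = 1\<^sub>m n"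
proof (rule eq_matI)
  fix a b assume "a < dim_row (1\<^sub>m n :: complex mat)" "b < dim_col (1\<^sub>m n :: complex mat)"
  then have "a < n" "b < n" by auto
  then show "(exchange_mat n * exchange_mat n) $$ (a, b) = 1\<^sub>m n $$ (a, b)"
    by (simp add: exchange_mat_mult_index[OF exchange_mat_carrier] del: index_mult_mat(1))
      (auto simp: exchange_mat_def)
qed (simp_all add: exchange_mat_def)

lemma odot_carrier: "X \<in> carrier_mat n n \<Longrightarrow> odot n X \<in> carrier_mat n n"
  unfolding odot_def by (intro mult_carrier_mat[where n = n]) auto

text \<open>Transposition and the index reversal each reverse the order of row and column index, so
  their composite sends upper-triangular units to upper-triangular units.\<close>

lemma odot_mat_unit:
  assumes "i < n" "j < n"
  shows "odot n (mat_unit n i j) = mat_unit n (n - Suc j) (n - Suc i)"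
proof (rule eq_matI)
  fix a b assume "a < dim_row (mat_unit n (n - Suc j) (n - Suc i) :: complex mat)"
    "b < dim_col (mat_unit n (n - Suc j) (n - Suc i) :: complex mat)"
  then have ab: "a < n" "b < n" by auto
  have "odot n (mat_unit n i j) $$ (a, b) = mat_unit n j i $$ (n - Suc a, n - Suc b)"
    unfolding odot_def transpose_mat_unit
    using ab mult_exchange_mat_index[OF mult_carrier_mat[OF exchange_mat_carrier mat_unit_carrier] ab]
    by (simp add: exchange_mat_mult_index del: index_mult_mat(1))
  then show "odot n (mat_unit n i j) $$ (a, b) = mat_unit n (n - Suc j) (n - Suc i) $$ (a, b)"
    using ab assms by auto
qed (simp_all add: odot_def exchange_mat_def)

section \<open>Landing in the target algebra\<close>

text \<open>Meant for \<open>f\<close> the identity or \<open>odot n\<close>. As \<open>f\<close>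
  reaches all upper-triangular units, \<open>conj_upper_units_mem\<close> puts \<open>U\<close> and
  \<open>V\<close> into \<open>B\<close>; then \<open>f X = V * \<phi> X * U\<close> lies in
  \<open>B\<close> too.\<close>

lemma conj_into_block_algebra:
  assumes A: "A \<subseteq> carrier_mat n n" and B: "block_upper_triangular_algebra n B"
    and U: "U \<in> carrier_mat n n" and V: "V \<in> carrier_mat n n" and UV: "U * V = 1\<^sub>m n"
    and f: "f ` A \<subseteq> carrier_mat n n"
    and units: "\<And>k l. k \<le> l \<Longrightarrow> l < n \<Longrightarrow> mat_unit n k l \<in> f ` A"
    and \<phi>: "\<phi> ` A \<subseteq> B" "\<And>X. X \<in> A \<Longrightarrow> \<phi> X = U * f X * V"
  shows "f ` A \<subseteq> B \<and> (\<exists>T \<in> alg_units n B. \<forall>X\<in>A. \<phi> X = T * f X * mat_inv T)"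
proof -
  have VU: "V * U = 1\<^sub>m n" using mat_mult_left_right_inverse[OF U V UV] .
  have "U * mat_unit n k l * V \<in> B" if "k \<le> l" "l < n" for k l
    using units[OF that] \<phi> by auto
  note mem = conj_upper_units_mem[OF B U V UV this]
  have mult: "Y * Z \<in> B" if "Y \<in> B" "Z \<in> B" for Y Z
    using B that unfolding block_upper_triangular_algebra_def matrix_subalgebra_def by blast
  have "f X \<in> B" if X: "X \<in> A" for X
  proof -
    have "f X = V * \<phi> X * U" using conj_cancel[OF _ U V VU, of "f X"] f X \<phi>(2) by auto
    then show ?thesis using mult mem \<phi>(1) X by auto
  qed
  moreover have "U \<in> alg_units n B" unfolding alg_units_def using mem UV VU by blast
  ultimately show ?thesis using \<phi>(2) mat_inv_eqI[OF U V UV] by blast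
qed

theorem corollary3p1:
  fixes n :: nat and A B :: "complex mat set" and \<phi> :: "complex mat \<Rightarrow> complex mat"
  assumes "n \<ge> 1"
    and "block_upper_triangular_algebra n A"
    and "block_upper_triangular_algebra n B"
    and "jordan_embedding A B \<phi>"
  shows "(A \<subseteq> B \<and> (\<exists>T \<in> alg_units n B. \<forall>X\<in>A. \<phi> X = T * X * mat_inv T))
       \<or> (odot n ` A \<subseteq> B \<and> (\<exists>T \<in> alg_units n B. \<forall>X\<in>A. \<phi> X = T * odot n X * mat_inv T))"
proof -
  note A = assms(2) and B = assms(3)
  have Ac: "A \<subseteq> carrier_mat n n" and Bc: "B \<subseteq> carrier_mat n n"
    using A B unfolding block_upper_triangular_algebra_def matrix_subalgebra_def by auto
  have \<phi>B: "\<phi> ` A \<subseteq> B" using assms(4) unfolding jordan_embedding_def jordan_hom_def by blast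
  \<comment> \<open>The codomain is enlarged to all matrices: the form of \<phi> is found first, and
    \<open>B\<close> returns only to locate the conjugator.\<close>
  then have "jordan_embedding A (carrier_mat n n) \<phi>"
    using assms(4) Bc unfolding jordan_embedding_def jordan_hom_def by blast
  from jordan_embedding_form[OF A this]
  obtain U V where U: "U \<in> carrier_mat n n" and V: "V \<in> carrier_mat n n" and UV: "U * V = 1\<^sub>m n"
    and form: "(\<forall>X\<in>A. \<phi> X = U * X * V) \<or> (\<forall>X\<in>A. \<phi> X = U * transpose_mat X * V)"
    by blast
  from form show ?thesis
  proof
    assume "\<forall>X\<in>A. \<phi> X = U * X * V"
    then have "(\<lambda>X. X) ` A \<subseteq> B \<and> (\<exists>T \<in> alg_units n B. \<forall>X\<in>A. \<phi> X = T * X * mat_inv T)"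
      using Ac mat_unit_mem_upper[OF A] by (intro conj_into_block_algebra[OF Ac B U V UV _ _ \<phi>B]) auto
    then show ?thesis by auto
  next
    assume tr: "\<forall>X\<in>A. \<phi> X = U * transpose_mat X * V"
    \<comment> \<open>Since \<open>J J = 1\<close>, inserting \<open>J\<close> on both sides of the
      transpose rewrites \<open>U X^t V\<close> as \<open>(U J) (J X^t J) (J V)\<close>, with
      \<open>U J\<close> as new conjugator.\<close>
    let ?J = "exchange_mat n"
      have "U * ?J * (?J * V) = U * (?J * ?J) * V"
      using carrier_matD[OF U] carrier_matD[OF V] carrier_matD[OF exchange_mat_carrier[of n]]
      by (simp add: mult_assoc_dim)
    then have UV': "U * ?J * (?J * V) = 1\<^sub>m n" using U UV by (simp add: exchange_mat_involution)
    have "\<phi> X = U * ?J * odot n X * (?J * V)" if X: "X \<in> A" for X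
    proof -
      have Xc: "transpose_mat X \<in> carrier_mat n n" using X Ac by auto
      have "U * ?J * odot n X * (?J * V) = U * (?J * odot n X * ?J) * V"
        using carrier_matD[OF U] carrier_matD[OF V] carrier_matD[OF exchange_mat_carrier[of n]]
          carrier_matD[OF odot_carrier[OF subsetD[OF Ac X]]]
        by (simp add: mult_assoc_dim)
      also have "?J * odot n X * ?J = transpose_mat X"
        unfolding odot_def by (rule conj_cancel[OF Xc _ _ exchange_mat_involution]) auto
      finally show ?thesis using tr X by simp
    qed
    moreover have "mat_unit n k l \<in> odot n ` A" if kl: "k \<le> l" "l < n" for k l
    proof -
      have "mat_unit n k l = odot n (mat_unit n (n - Suc l) (n - Suc k))"
        using kl by (subst odot_mat_unit) auto
      then show ?thesis using mat_unit_mem_upper[OF A, of "n - Suc l" "n - Suc k"] kl by auto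
    qed
    moreover have "odot n ` A \<subseteq> carrier_mat n n" using Ac odot_carrier by auto
    ultimately have "odot n ` A \<subseteq> B \<and>
        (\<exists>T \<in> alg_units n B. \<forall>X\<in>A. \<phi> X = T * odot n X * mat_inv T)"
      using mult_carrier_mat[OF U exchange_mat_carrier] mult_carrier_mat[OF exchange_mat_carrier V]
      by (intro conj_into_block_algebra[OF Ac B _ _ UV' _ _ \<phi>B])
    then show ?thesis by blast
  qed
qed

end
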